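(* Let $\mathbb{K}$ be a field, $R=\mathbb{K}[X_1,\ldots,X_n]$, and let $I\subset R$ be a monomial ideal. If $I$ is normally torsion-free, then $I^{[m]}$ is normally torsion-free for all integers $m\ge 2$.
   Context: For $f\in R$ and a positive integer $m$, $f^{[m]}:=f(X_1^m,\ldots,X_n^m)$, and the $m$-th square power of an ideal $I\subset R$ is the ideal $I^{[m]}:=\langle f^{[m]} : f\in I\rangle$ of $R$. $\operatorname{Ass}(I)$ denotes the set of associated primes of $R/I$. An ideal $I$ of $R$ is called normally torsion-free if $\operatorname{Ass}(I^s)\subseteq\operatorname{Ass}(I)$ for all $s\ge 1$. *)

theory Defs
  imports
    "HOL-Algebra.QuotRing"
    "HOL-Algebra.Ideal_Product"
    "HOL-Library.Poly_Mapping"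
begin

section \<open>Associated primes and normal torsion-freeness in a commutative ring\<close>

text \<open>
  The associated primes of the \<open>R\<close>-module \<open>R/I\<close>: the prime ideals of \<open>R\<close> that are the annihilator
  of some element of \<open>R/I\<close>. An element \<open>r\<close> acts on \<open>R/I\<close> as multiplication by its residue class.
\<close>

definition Ass :: "('a, 'b) ring_scheme \<Rightarrow> 'a set \<Rightarrow> 'a set set" where
  "Ass R I = {P. primeideal P R \<and>
     (\<exists>x \<in> carrier (R Quot I).
        P = {r \<in> carrier R. (I +>\<^bsub>R\<^esub> r) \<otimes>\<^bsub>R Quot I\<^esub> x = \<zero>\<^bsub>R Quot I\<^esub>})}"

lemma (in ideal) Ass_iff_colon:
  "P \<in> Ass R I \<longleftrightarrow>
     primeideal P R \<and> (\<exists>f \<in> carrier R. P = {r \<in> carrier R. r \<otimes> f \<in> I})"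
proof -
  have coset: "(I +> r) \<otimes>\<^bsub>R Quot I\<^esub> (I +> f) = \<zero>\<^bsub>R Quot I\<^esub> \<longleftrightarrow> r \<otimes> f \<in> I"
    if "r \<in> carrier R" "f \<in> carrier R" for r f
  proof -
    have "I +> g = I \<longleftrightarrow> g \<in> I" if "g \<in> carrier R" for g
      using that a_rcos_self[of g] a_rcos_const[of g] by metis
    with that show ?thesis
      by (simp add: FactRing_def rcoset_mult_add)
  qed
  have carrier: "carrier (R Quot I) = (+>) I ` carrier R"
    by (auto simp: FactRing_def A_RCOSETS_def')
  have "(\<exists>x \<in> carrier (R Quot I).
        P = {r \<in> carrier R. (I +> r) \<otimes>\<^bsub>R Quot I\<^esub> x = \<zero>\<^bsub>R Quot I\<^esub>}) \<longleftrightarrow>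
      (\<exists>f \<in> carrier R. P = {r \<in> carrier R. r \<otimes> f \<in> I})"
    unfolding carrier bex_simps using coset by (simp cong: conj_cong)
  then show ?thesis
    by (simp add: Ass_def)
qed

text \<open>The power \<open>I\<^sup>s\<close> is the power of \<open>I\<close> in the multiplicative monoid of ideals.\<close>

definition normally_torsion_free :: "('a, 'b) ring_scheme \<Rightarrow> 'a set \<Rightarrow> bool" where
  "normally_torsion_free R I \<longleftrightarrow>
     (\<forall>s::nat. s \<ge> 1 \<longrightarrow> Ass R (I [^]\<^bsub>ideals_set R\<^esub> s) \<subseteq> Ass R I)"

section \<open>The polynomial ring\<close>

text \<open>
  A polynomial in the variables \<open>X\<^sub>i\<close>, \<open>i :: 'n\<close>, with coefficients in \<open>'k\<close> maps each exponent
  vector to its coefficient; multiplication of \<^const>\<open>Poly_Mapping.single\<close>s adds exponent vectors.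
\<close>

type_synonym ('n, 'k) mpoly = "('n \<Rightarrow>\<^sub>0 nat) \<Rightarrow>\<^sub>0 'k"

definition mpoly_ring :: "('n, 'k::comm_ring_1) mpoly ring" where
  "mpoly_ring = \<lparr>carrier = UNIV, monoid.mult = (*), one = 1, ring.zero = 0, add = (+)\<rparr>"

lemma cring_mpoly_ring: "cring (mpoly_ring :: ('n, 'k::comm_ring_1) mpoly ring)"
proof (rule cringI)
  show "abelian_group (mpoly_ring :: ('n, 'k) mpoly ring)"
  proof (rule abelian_groupI)
    show "\<exists>y \<in> carrier mpoly_ring. y \<oplus>\<^bsub>mpoly_ring\<^esub> x = \<zero>\<^bsub>mpoly_ring\<^esub>"
      for x :: "('n, 'k) mpoly"
      by (rule bexI[of _ "- x"]) (simp_all add: mpoly_ring_def)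
  qed (simp_all add: mpoly_ring_def add_ac)
  show "Group.comm_monoid (mpoly_ring :: ('n, 'k) mpoly ring)"
    by (rule comm_monoidI) (simp_all add: mpoly_ring_def mult_ac)
qed (simp add: mpoly_ring_def distrib_right)

definition mvar :: "'n \<Rightarrow> ('n, 'k::comm_ring_1) mpoly" where
  "mvar i = Poly_Mapping.single (Poly_Mapping.single i 1) 1"

definition mconst :: "'k \<Rightarrow> ('n, 'k::comm_ring_1) mpoly" where
  "mconst c = Poly_Mapping.single 0 c"

definition monomial :: "('n \<Rightarrow>\<^sub>0 nat) \<Rightarrow> ('n::finite, 'k::comm_ring_1) mpoly" where
  "monomial a = (\<Prod>i\<in>UNIV. mvar i ^ Poly_Mapping.lookup a i)"

text \<open>The substitution \<open>f(g\<^sub>1, \<dots>, g\<^sub>n)\<close>.\<close>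

definition msubst ::
    "('n::finite, 'k::comm_ring_1) mpoly \<Rightarrow> ('n \<Rightarrow> ('n, 'k) mpoly) \<Rightarrow> ('n, 'k) mpoly" where
  "msubst f g =
     (\<Sum>a\<in>Poly_Mapping.keys f.
        mconst (Poly_Mapping.lookup f a) * (\<Prod>i\<in>UNIV. g i ^ Poly_Mapping.lookup a i))"

definition poly_square_power ::
    "nat \<Rightarrow> ('n::finite, 'k::comm_ring_1) mpoly \<Rightarrow> ('n, 'k) mpoly" where
  "poly_square_power m f = msubst f (\<lambda>i. mvar i ^ m)"

definition ideal_square_power ::
    "nat \<Rightarrow> ('n::finite, 'k::comm_ring_1) mpoly set \<Rightarrow> ('n, 'k) mpoly set" where
  "ideal_square_power m I = genideal mpoly_ring {poly_square_power m f | f. f \<in> I}"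

text \<open>The set of generators may be empty (\<open>I = 0\<close>) or contain \<open>1\<close> (\<open>I = R\<close>).\<close>

definition monomial_ideal :: "('n::finite, 'k::comm_ring_1) mpoly set \<Rightarrow> bool" where
  "monomial_ideal I \<longleftrightarrow> (\<exists>A. I = genideal mpoly_ring (monomial ` A))"

lemma monomial_eq_single:
  "(monomial a :: ('n::finite, 'k::comm_ring_1) mpoly) = Poly_Mapping.single a 1"
proof -
  have pow: "(mvar i :: ('n, 'k) mpoly) ^ e =
      Poly_Mapping.single (Poly_Mapping.single i e) 1" for i e
    by (induction e) (simp_all add: mvar_def mult_single flip: single_add)
  have prod: "(\<Prod>i\<in>S. Poly_Mapping.single (b i) (1::'k)) = Poly_Mapping.single (sum b S) 1"
    if "finite S" for S :: "'n set" and b :: "'n \<Rightarrow> ('n \<Rightarrow>\<^sub>0 nat)"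
    using that by induction (simp_all add: mult_single)
  have "(\<Sum>i\<in>UNIV. Poly_Mapping.single i (Poly_Mapping.lookup a i)) = a"
    by (rule poly_mapping_eqI) (simp add: lookup_sum lookup_single when_def)
  then show ?thesis
    by (simp add: monomial_def pow prod)
qed

end

theory Submission
  imports Defs
begin

text \<open>
  For a monomial ideal \<open>J\<close>, an associated prime \<open>(J : f)\<close> is itself a monomial ideal and equals
  \<open>(J : x\<^sup>a)\<close> for a single monomial \<open>x\<^sup>a\<close>. Since \<open>x\<^sup>b \<in> J\<^bsup>[m]\<^esup>\<close> iff \<open>x\<^bsup>b div m\<^esup> \<in> J\<close>, a monomial
  prime \<open>P\<close> is \<open>(J\<^bsup>[m]\<^esup> : x\<^sup>b)\<close> only if it is \<open>(J : x\<^bsup>b div m\<^esup>)\<close>, and it is \<open>(J : x\<^sup>a)\<close> only if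
  it is \<open>(J\<^bsup>[m]\<^esup> : x\<^bsup>ma + (m - 1, \<dots>, m - 1)\<^esup>)\<close>. So \<open>J\<close> and \<open>J\<^bsup>[m]\<^esup>\<close> have the same associated
  primes. As \<open>(I\<^bsup>[m]\<^esup>)\<^sup>s = (I\<^sup>s)\<^bsup>[m]\<^esup>\<close>, taking \<open>J = I\<^sup>s\<close> and \<open>J = I\<close> gives the theorem.
\<close>

section \<open>Exponent vectors\<close>

text \<open>The variable type is finite, so every function on it has finite support and
  \<open>Abs_poly_mapping\<close> is a genuine inverse of \<open>lookup\<close>.\<close>

definition exponent_vec :: "('n::finite \<Rightarrow> nat) \<Rightarrow> ('n \<Rightarrow>\<^sub>0 nat)" where
  "exponent_vec = Abs_poly_mapping"

lemma lookup_exponent_vec [simp]: "Poly_Mapping.lookup (exponent_vec f) = f"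
  by (simp add: exponent_vec_def)

definition scale :: "nat \<Rightarrow> ('n::finite \<Rightarrow>\<^sub>0 nat) \<Rightarrow> ('n \<Rightarrow>\<^sub>0 nat)" where
  "scale m a = exponent_vec (\<lambda>i. m * Poly_Mapping.lookup a i)"

lemma lookup_scale [simp]: "Poly_Mapping.lookup (scale m a) i = m * Poly_Mapping.lookup a i"
  by (simp add: scale_def)

lemma scale_0_right [simp]: "scale m 0 = 0"
  by (rule poly_mapping_eqI) simp

lemma scale_0 [simp]: "scale 0 a = 0"
  by (rule poly_mapping_eqI) simp

lemma scale_Suc: "scale (Suc m) a = a + scale m a"
  by (rule poly_mapping_eqI) (simp add: lookup_add)

lemma scale_add: "scale m (a + b) = scale m a + scale m b"
  by (rule poly_mapping_eqI) (simp add: lookup_add algebra_simps)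

text \<open>These are the exponent sets of monomial ideals: closure under adding \<open>v\<close> is
  closure of the monomials under multiplication by \<open>x^v\<close>.\<close>

definition upclosed :: "('a \<Rightarrow>\<^sub>0 nat) set \<Rightarrow> bool" where
  "upclosed U \<longleftrightarrow> (\<forall>u\<in>U. \<forall>v. v + u \<in> U)"

lemma upclosedD: "upclosed U \<Longrightarrow> u \<in> U \<Longrightarrow> v + u \<in> U"
  by (simp add: upclosed_def)

lemma upclosed_lookup_mono:
  assumes "upclosed U" "u \<in> U" "\<And>i. Poly_Mapping.lookup u i \<le> Poly_Mapping.lookup v i"
  shows "v \<in> U"
proof -
  have "v = (v - u) + u"
    by (rule poly_mapping_eqI) (simp add: lookup_add lookup_minus assms(3))
  with assms upclosedD show ?thesis by metis
qed

text \<open>Stands in for the leading terms of a monomial order. Restricting both sets to the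
  elements of maximal \<open>i\<close>-th coordinate loses no competitors: a sum of two maxima is
  reached only by two maxima. Repeating this with varying coordinates leaves singletons.\<close>

lemma ex_unique_sum:
  fixes S T :: "('a \<Rightarrow>\<^sub>0 nat) set"
  assumes "finite S" "finite T" "S \<noteq> {}" "T \<noteq> {}"
  shows "\<exists>u\<in>S. \<exists>v\<in>T. \<forall>u'\<in>S. \<forall>v'\<in>T. u' + v' = u + v \<longrightarrow> u' = u \<and> v' = v"
  using assms
proof (induction "card S + card T" arbitrary: S T rule: less_induct)
  case less
  show ?case
  proof (cases "\<exists>i. \<exists>a\<in>S. \<exists>b\<in>S. \<exists>c\<in>T. \<exists>d\<in>T.
      Poly_Mapping.lookup a i \<noteq> Poly_Mapping.lookup b i \<or>
      Poly_Mapping.lookup c i \<noteq> Poly_Mapping.lookup d i")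
    case False
    obtain u v where "u \<in> S" "v \<in> T" using less.prems by auto
    moreover have "u' = u" if "u' \<in> S" for u'
      using False that calculation by (intro poly_mapping_eqI) blast
    moreover have "v' = v" if "v' \<in> T" for v'
      using False that \<open>u \<in> S\<close> \<open>v \<in> T\<close> by (intro poly_mapping_eqI) blast
    ultimately show ?thesis by blast
  next
    case True
    then obtain i a b c d where abcd: "a \<in> S" "b \<in> S" "c \<in> T" "d \<in> T"
      "Poly_Mapping.lookup a i \<noteq> Poly_Mapping.lookup b i \<or>
       Poly_Mapping.lookup c i \<noteq> Poly_Mapping.lookup d i" by blast
    define top where
      "top W = {w\<in>W. \<forall>w'\<in>W. Poly_Mapping.lookup w' i \<le> Poly_Mapping.lookup w i}"
      for W :: "('a \<Rightarrow>\<^sub>0 nat) set"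
    have top_ne: "top W \<noteq> {}" if W: "finite W" "W \<noteq> {}" for W
    proof -
      have "Max ((\<lambda>w. Poly_Mapping.lookup w i) ` W) \<in> (\<lambda>w. Poly_Mapping.lookup w i) ` W"
        using W by (intro Max_in) auto
      then obtain w where w: "w \<in> W"
        "Max ((\<lambda>w. Poly_Mapping.lookup w i) ` W) = Poly_Mapping.lookup w i"
        by auto
      have "w \<in> top W"
        unfolding top_def using W w(1) by (auto simp flip: w(2))
      then show ?thesis by blast
    qed
    have sub: "top W \<subseteq> W" for W by (auto simp: top_def)
    \<comment> \<open>If both sets coincided with their tops, coordinate \<open>i\<close> would be
      constant on each, against its choice.\<close>
    have "top S \<subset> S \<or> top T \<subset> T"
      using abcd sub[of S] sub[of T] unfolding top_def
      by (smt (verit) dual_order.antisym mem_Collect_eq psubsetI)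
    then have "card (top S) + card (top T) < card S + card T"
      using less.prems(1,2) sub[of S] sub[of T]
      by (meson add_le_less_mono add_less_le_mono card_mono psubset_card_mono)
    moreover have "finite (top S)" "finite (top T)"
      using less.prems sub finite_subset by metis+
    moreover have "top S \<noteq> {}" "top T \<noteq> {}"
      using top_ne less.prems by simp_all
    ultimately have "\<exists>u\<in>top S. \<exists>v\<in>top T. \<forall>u'\<in>top S. \<forall>v'\<in>top T.
        u' + v' = u + v \<longrightarrow> u' = u \<and> v' = v"
      by (rule less.hyps)
    then obtain u v where uv: "u \<in> top S" "v \<in> top T"
      and uniq: "\<And>u' v'. u' \<in> top S \<Longrightarrow> v' \<in> top T \<Longrightarrow> u' + v' = u + v \<Longrightarrow> u' = u \<and> v' = v"
      by (elim bexE) simp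
    have "u' = u \<and> v' = v" if "u' \<in> S" "v' \<in> T" "u' + v' = u + v" for u' v'
    proof (rule uniq)
      have "Poly_Mapping.lookup u' i + Poly_Mapping.lookup v' i =
          Poly_Mapping.lookup u i + Poly_Mapping.lookup v i"
        by (metis lookup_add that(3))
      moreover have "Poly_Mapping.lookup u' i \<le> Poly_Mapping.lookup u i"
          "Poly_Mapping.lookup v' i \<le> Poly_Mapping.lookup v i"
        using uv that by (auto simp: top_def)
      ultimately have "Poly_Mapping.lookup u' i = Poly_Mapping.lookup u i"
          "Poly_Mapping.lookup v' i = Poly_Mapping.lookup v i"
        by linarith+
      then show "u' \<in> top S" "v' \<in> top T"
        using uv that by (auto simp: top_def)
    qed fact
    with uv sub show ?thesis by blast
  qed
qed

section \<open>Monomial ideals\<close>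

lemma poly_eq_sum_single: "f = (\<Sum>a\<in>Poly_Mapping.keys f. Poly_Mapping.single a (Poly_Mapping.lookup f a))"
  by (rule poly_mapping_eqI) (auto simp: lookup_sum lookup_single when_def in_keys_iff)

lemma lookup_mult_sum:
  fixes f g :: "('n, 'k::comm_ring_1) mpoly"
  shows "Poly_Mapping.lookup (f * g) c =
    (\<Sum>a\<in>Poly_Mapping.keys f. \<Sum>b\<in>Poly_Mapping.keys g.
       if a + b = c then Poly_Mapping.lookup f a * Poly_Mapping.lookup g b else 0)"
proof -
  have "f * g = (\<Sum>a\<in>Poly_Mapping.keys f. \<Sum>b\<in>Poly_Mapping.keys g.
      Poly_Mapping.single (a + b) (Poly_Mapping.lookup f a * Poly_Mapping.lookup g b))"
    by (subst poly_eq_sum_single[of f], subst poly_eq_sum_single[of g])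
       (simp add: sum_product mult_single)
  then show ?thesis
    by (simp add: lookup_sum lookup_single when_def)
qed

text \<open>Exactly one pair of terms contributes to the coefficient at \<open>u + v\<close>, so no
  cancellation can occur there.\<close>

lemma lookup_mult_unique_sum:
  fixes f g :: "('n, 'k::comm_ring_1) mpoly"
  assumes "\<And>a b. a \<in> Poly_Mapping.keys f \<Longrightarrow> b \<in> Poly_Mapping.keys g \<Longrightarrow> a + b = u + v \<Longrightarrow> a = u \<and> b = v"
    and u: "u \<in> Poly_Mapping.keys f" and v: "v \<in> Poly_Mapping.keys g"
  shows "Poly_Mapping.lookup (f * g) (u + v) = Poly_Mapping.lookup f u * Poly_Mapping.lookup g v"
proof -
  have "Poly_Mapping.lookup (f * g) (u + v) =
      (\<Sum>a\<in>Poly_Mapping.keys f. \<Sum>b\<in>Poly_Mapping.keys g.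
        if a = u \<and> b = v then Poly_Mapping.lookup f a * Poly_Mapping.lookup g b else 0)"
    unfolding lookup_mult_sum using assms(1) by (intro sum.cong refl) auto
  also have "\<dots> = (\<Sum>a\<in>Poly_Mapping.keys f.
      if a = u then Poly_Mapping.lookup f a * Poly_Mapping.lookup g v else 0)"
    using v by (intro sum.cong refl) auto
  also have "\<dots> = Poly_Mapping.lookup f u * Poly_Mapping.lookup g v"
    using u by simp
  finally show ?thesis .
qed

lemma keys_mult_single:
  fixes f :: "('n, 'k::comm_ring_1) mpoly"
  shows "Poly_Mapping.keys (f * Poly_Mapping.single a 1) = (\<lambda>c. c + a) ` Poly_Mapping.keys f"
proof
  show "Poly_Mapping.keys (f * Poly_Mapping.single a 1) \<subseteq> (\<lambda>c. c + a) ` Poly_Mapping.keys f"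
    using keys_mult[of f "Poly_Mapping.single a 1"] by auto
  show "(\<lambda>c. c + a) ` Poly_Mapping.keys f \<subseteq> Poly_Mapping.keys (f * Poly_Mapping.single a 1)"
  proof clarify
    fix c assume "c \<in> Poly_Mapping.keys f"
    then show "c + a \<in> Poly_Mapping.keys (f * Poly_Mapping.single a 1)"
      using lookup_mult_unique_sum[of f "Poly_Mapping.single a 1" c a] by (simp add: in_keys_iff)
  qed
qed

section \<open>Ideals spanned by monomials\<close>

lemma ideal_mpoly_ring_iff:
  fixes I :: "('n, 'k::comm_ring_1) mpoly set"
  shows "ideal I mpoly_ring \<longleftrightarrow>
    0 \<in> I \<and> (\<forall>f\<in>I. \<forall>g\<in>I. f + g \<in> I) \<and> (\<forall>f. \<forall>g\<in>I. f * g \<in> I)" (is "_ \<longleftrightarrow> ?C")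
proof
  interpret R: cring "mpoly_ring :: ('n, 'k) mpoly ring" by (rule cring_mpoly_ring)
  {
    assume "ideal I mpoly_ring"
    then interpret ideal I mpoly_ring .
    show ?C
      using zero_closed a_closed I_l_closed by (auto simp: mpoly_ring_def)
  }
  assume C: ?C
  show "ideal I mpoly_ring"
  proof (rule idealI)
    show "subgroup I (add_monoid mpoly_ring)"
    proof (rule R.add.subgroupI)
      fix f assume f: "f \<in> I"
      have "\<ominus>\<^bsub>mpoly_ring\<^esub> f = - f"
        by (rule R.minus_equality) (simp_all add: mpoly_ring_def)
      moreover have "(-1) * f \<in> I" using C f by blast
      ultimately show "\<ominus>\<^bsub>mpoly_ring\<^esub> f \<in> I" by simp
    qed (use C in \<open>auto simp: mpoly_ring_def\<close>)
    show "f \<otimes>\<^bsub>mpoly_ring\<^esub> g \<in> I" "g \<otimes>\<^bsub>mpoly_ring\<^esub> f \<in> I" if "g \<in> I" for f g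
      using C that by (simp_all add: mpoly_ring_def mult.commute[of g])
  qed (rule R.ring_axioms)
qed

lemma ideal_sum_mem:
  fixes I :: "('n, 'k::comm_ring_1) mpoly set"
  assumes "ideal I mpoly_ring" "\<And>a. a \<in> A \<Longrightarrow> f a \<in> I"
  shows "sum f A \<in> I"
  using assms(2)
  by (induction A rule: infinite_finite_induct) (use assms(1) in \<open>auto simp: ideal_mpoly_ring_iff\<close>)

text \<open>The linear span of the monomials with exponents in \<open>U\<close>; it is an ideal when
  \<open>U\<close> is up-closed.\<close>

definition exponent_ideal :: "('n \<Rightarrow>\<^sub>0 nat) set \<Rightarrow> ('n, 'k::comm_ring_1) mpoly set" where
  "exponent_ideal U = {f. Poly_Mapping.keys f \<subseteq> U}"

lemma single_in_exponent_ideal [simp]: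
  "Poly_Mapping.single a (1::'k::comm_ring_1) \<in> exponent_ideal U \<longleftrightarrow> a \<in> U"
  by (simp add: exponent_ideal_def)

lemma ideal_exponent_ideal:
  assumes "upclosed U"
  shows "ideal (exponent_ideal U :: ('n, 'k::comm_ring_1) mpoly set) mpoly_ring"
  unfolding ideal_mpoly_ring_iff exponent_ideal_def
proof (intro conjI allI ballI; clarsimp)
  show "c \<in> U" if "Poly_Mapping.keys f \<subseteq> U" "Poly_Mapping.keys g \<subseteq> U"
      "c \<in> Poly_Mapping.keys (f + g)" for f g :: "('n, 'k) mpoly" and c
    using that keys_add[of f g] by blast
  show "c \<in> U" if "Poly_Mapping.keys g \<subseteq> U" "c \<in> Poly_Mapping.keys (f * g)"
      for f g :: "('n, 'k) mpoly" and c
    using that keys_mult[of f g] upclosedD[OF assms] by blast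
qed

lemma exponent_ideal_subset:
  fixes J :: "('n, 'k::comm_ring_1) mpoly set"
  assumes J: "ideal J mpoly_ring" and U: "\<And>u. u \<in> U \<Longrightarrow> Poly_Mapping.single u 1 \<in> J"
  shows "exponent_ideal U \<subseteq> J"
proof
  fix f :: "('n, 'k) mpoly" assume f: "f \<in> exponent_ideal U"
  have "Poly_Mapping.single a (Poly_Mapping.lookup f a) \<in> J" if "a \<in> Poly_Mapping.keys f" for a
  proof -
    have "Poly_Mapping.single 0 (Poly_Mapping.lookup f a) * Poly_Mapping.single a 1 \<in> J"
      using J U that f by (auto simp: ideal_mpoly_ring_iff exponent_ideal_def)
    then show ?thesis by (simp add: mult_single)
  qed
  then show "f \<in> J"
    by (subst poly_eq_sum_single) (rule ideal_sum_mem[OF J])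
qed

text \<open>\<open>S\<close> may contain polynomials with several terms, as the generators of a
  square power do; it suffices that each monomial with exponent in \<open>U\<close> is a multiple of
  a monomial belonging to \<open>S\<close>.\<close>

lemma genideal_eq_exponent_ideal:
  fixes S :: "('n, 'k::comm_ring_1) mpoly set"
  assumes "upclosed U" "S \<subseteq> exponent_ideal U"
    and "\<And>u. u \<in> U \<Longrightarrow> \<exists>a b. u = b + a \<and> Poly_Mapping.single a 1 \<in> S"
  shows "genideal mpoly_ring S = exponent_ideal U"
proof
  interpret R: cring "mpoly_ring :: ('n, 'k) mpoly ring" by (rule cring_mpoly_ring)
  have S: "S \<subseteq> carrier mpoly_ring" by (simp add: mpoly_ring_def)
  show "genideal mpoly_ring S \<subseteq> exponent_ideal U"
    using assms ideal_exponent_ideal by (intro R.genideal_minimal) auto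
  show "exponent_ideal U \<subseteq> genideal mpoly_ring S"
  proof (rule exponent_ideal_subset)
    show gen: "ideal (genideal mpoly_ring S) mpoly_ring" by (rule R.genideal_ideal[OF S])
    fix u assume "u \<in> U"
    then obtain a b where u: "u = b + a" "Poly_Mapping.single a 1 \<in> S" using assms(3) by blast
    then have "Poly_Mapping.single a 1 \<in> genideal mpoly_ring S" using R.genideal_self[OF S] by blast
    then have "Poly_Mapping.single b 1 * Poly_Mapping.single a 1 \<in> genideal mpoly_ring S"
      using gen by (auto simp: ideal_mpoly_ring_iff)
    then show "Poly_Mapping.single u 1 \<in> genideal mpoly_ring S" by (simp add: u mult_single)
  qed
qed

lemma monomial_ideal_eq_exponent_ideal:
  fixes I :: "('n::finite, 'k::comm_ring_1) mpoly set"
  assumes "monomial_ideal I"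
  obtains U where "upclosed U" "I = exponent_ideal U"
proof -
  obtain A where A: "I = genideal mpoly_ring (monomial ` A)"
    using assms by (auto simp: monomial_ideal_def)
  define U where "U = {b + a | a b. a \<in> A}"
  have U: "upclosed U" unfolding upclosed_def U_def by clarsimp (metis add.assoc)
  moreover have "b \<in> A \<Longrightarrow> b \<in> U" for b
    unfolding U_def by (metis (mono_tags, lifting) add_0 mem_Collect_eq)
  ultimately have "I = exponent_ideal U"
    unfolding A by (intro genideal_eq_exponent_ideal) (auto simp: monomial_eq_single U_def)
  with U that show thesis by blast
qed

section \<open>Products and powers of monomial ideals\<close>

definition exponent_sum :: "('n \<Rightarrow>\<^sub>0 nat) set \<Rightarrow> ('n \<Rightarrow>\<^sub>0 nat) set \<Rightarrow> ('n \<Rightarrow>\<^sub>0 nat) set" where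
  "exponent_sum U V = {u + v | u v. u \<in> U \<and> v \<in> V}"

lemma upclosed_exponent_sum: "upclosed U \<Longrightarrow> upclosed (exponent_sum U V)"
  unfolding upclosed_def exponent_sum_def by clarsimp (metis add.assoc)

lemma ideal_prod_exponent_ideal:
  assumes U: "upclosed U" and V: "upclosed V"
  shows "ideal_prod mpoly_ring (exponent_ideal U) (exponent_ideal V) =
    (exponent_ideal (exponent_sum U V) :: ('n, 'k::comm_ring_1) mpoly set)"
proof
  interpret R: cring "mpoly_ring :: ('n, 'k) mpoly ring" by (rule cring_mpoly_ring)
  note ideals = ideal_exponent_ideal[OF U] ideal_exponent_ideal[OF V]
  show "ideal_prod mpoly_ring (exponent_ideal U) (exponent_ideal V) \<subseteq>
      (exponent_ideal (exponent_sum U V) :: ('n, 'k) mpoly set)"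
  proof
    fix f :: "('n, 'k) mpoly"
    assume "f \<in> ideal_prod mpoly_ring (exponent_ideal U) (exponent_ideal V)"
    then show "f \<in> exponent_ideal (exponent_sum U V)"
    proof induction
      case (prod f g)
      then show ?case
        using keys_mult[of f g] by (auto simp: exponent_ideal_def exponent_sum_def mpoly_ring_def) blast
    next
      case (sum f g)
      then show ?case
        using keys_add[of f g] by (auto simp: exponent_ideal_def mpoly_ring_def)
    qed
  qed
  show "(exponent_ideal (exponent_sum U V) :: ('n, 'k) mpoly set) \<subseteq>
      ideal_prod mpoly_ring (exponent_ideal U) (exponent_ideal V)"
  proof (rule exponent_ideal_subset)
    show "ideal (ideal_prod mpoly_ring (exponent_ideal U) (exponent_ideal V))
        (mpoly_ring :: ('n, 'k) mpoly ring)"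
      using ideals by (rule R.ideal_prod_is_ideal)
    fix w assume "w \<in> exponent_sum U V"
    then obtain u v where w: "w = u + v" "u \<in> U" "v \<in> V" by (auto simp: exponent_sum_def)
    then have "Poly_Mapping.single u 1 \<otimes>\<^bsub>mpoly_ring\<^esub> Poly_Mapping.single v (1::'k) \<in>
        ideal_prod mpoly_ring (exponent_ideal U) (exponent_ideal V)"
      by (intro ideal_prod.prod) simp_all
    then show "Poly_Mapping.single w (1::'k) \<in>
        ideal_prod mpoly_ring (exponent_ideal U) (exponent_ideal V)"
      by (simp add: w mpoly_ring_def mult_single)
  qed
qed

text \<open>The value \<open>UNIV\<close> at 0 reflects that the zeroth power of an ideal is the
  whole ring.\<close>

primrec exponent_power :: "('n \<Rightarrow>\<^sub>0 nat) set \<Rightarrow> nat \<Rightarrow> ('n \<Rightarrow>\<^sub>0 nat) set" where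
  "exponent_power U 0 = UNIV"
| "exponent_power U (Suc s) = exponent_sum (exponent_power U s) U"

lemma upclosed_exponent_power: "upclosed (exponent_power U s)"
  by (induction s) (auto simp: upclosed_exponent_sum upclosed_def[of UNIV])

lemma ideal_power_exponent_ideal:
  assumes "upclosed U"
  shows "exponent_ideal U [^]\<^bsub>ideals_set mpoly_ring\<^esub> s =
    (exponent_ideal (exponent_power U s) :: ('n, 'k::comm_ring_1) mpoly set)"
proof (induction s)
  case 0
  show ?case by (simp add: nat_pow_def ideals_set_def exponent_ideal_def mpoly_ring_def)
next
  case (Suc s)
  then show ?case
    using ideal_prod_exponent_ideal[OF upclosed_exponent_power assms]
    by (simp add: nat_pow_def ideals_set_def)
qed

section \<open>Square powers of monomial ideals\<close>

text \<open>The scaled vectors alone are in general not up-closed, hence the added \<open>b\<close>;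
  the result is the exponent set of the square power.\<close>

definition upscale :: "nat \<Rightarrow> ('n::finite \<Rightarrow>\<^sub>0 nat) set \<Rightarrow> ('n \<Rightarrow>\<^sub>0 nat) set" where
  "upscale m U = {b + scale m u | b u. u \<in> U}"

lemma upclosed_upscale: "upclosed (upscale m U)"
  unfolding upclosed_def upscale_def by clarsimp (metis add.assoc)

text \<open>The largest \<open>q\<close> with \<open>m * q\<close> below \<open>b\<close> in every
  coordinate is the coordinatewise quotient, and up-closedness makes it enough to test this
  \<open>q\<close>.\<close>

lemma upscale_iff_div:
  assumes U: "upclosed U" and m: "m > 0"
  shows "b \<in> upscale m U \<longleftrightarrow> exponent_vec (\<lambda>i. Poly_Mapping.lookup b i div m) \<in> U"
    (is "_ \<longleftrightarrow> ?q \<in> U")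
proof
  assume "b \<in> upscale m U"
  then obtain c u where b: "b = c + scale m u" "u \<in> U" by (auto simp: upscale_def)
  show "?q \<in> U"
    by (rule upclosed_lookup_mono[OF U b(2)]) (use m in \<open>simp add: b(1) lookup_add\<close>)
next
  assume q: "?q \<in> U"
  have "b = (b - scale m ?q) + scale m ?q"
    by (rule poly_mapping_eqI) (simp add: lookup_add lookup_minus)
  with q show "b \<in> upscale m U" by (auto simp: upscale_def)
qed

lemma poly_square_power_eq:
  fixes f :: "('n::finite, 'k::comm_ring_1) mpoly"
  shows "poly_square_power m f =
    (\<Sum>a\<in>Poly_Mapping.keys f. Poly_Mapping.single (scale m a) (Poly_Mapping.lookup f a))"
proof -
  have "(\<Prod>i\<in>UNIV. (mvar i ^ m) ^ Poly_Mapping.lookup a i) =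
      (monomial (scale m a) :: ('n, 'k) mpoly)" for a
    by (simp add: monomial_def power_mult)
  then show ?thesis
    by (simp add: poly_square_power_def msubst_def monomial_eq_single mconst_def mult_single)
qed

text \<open>All terms of \<open>f^[m]\<close> have exponents \<open>m * a\<close> for terms
  \<open>x^a\<close> of \<open>f\<close>. Conversely, each monomial \<open>x^u\<close> of the ideal
  yields the generator \<open>x^(m * u)\<close>.\<close>

lemma ideal_square_power_exponent_ideal:
  assumes "upclosed U"
  shows "ideal_square_power m (exponent_ideal U) =
    (exponent_ideal (upscale m U) :: ('n::finite, 'k::comm_ring_1) mpoly set)"
  unfolding ideal_square_power_def
proof (rule genideal_eq_exponent_ideal)
  have scale: "scale m u \<in> upscale m U" if "u \<in> U" for u
    using that unfolding upscale_def by (metis (mono_tags, lifting) add_0 mem_Collect_eq)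
  show "{poly_square_power m f |f. f \<in> exponent_ideal U} \<subseteq>
      (exponent_ideal (upscale m U) :: ('n, 'k) mpoly set)"
  proof clarify
    fix f :: "('n, 'k) mpoly" assume f: "f \<in> exponent_ideal U"
    show "poly_square_power m f \<in> exponent_ideal (upscale m U)"
      unfolding poly_square_power_eq using f scale
      by (intro ideal_sum_mem[OF ideal_exponent_ideal[OF upclosed_upscale]])
        (auto simp: exponent_ideal_def)
  qed
  fix w assume "w \<in> upscale m U"
  then obtain b u where w: "w = b + scale m u" "u \<in> U" by (auto simp: upscale_def)
  have "poly_square_power m (Poly_Mapping.single u (1::'k)) = Poly_Mapping.single (scale m u) 1"
    by (simp add: poly_square_power_eq)
  with w show "\<exists>a b. w = b + a \<and>
      Poly_Mapping.single a (1::'k) \<in> {poly_square_power m f |f. f \<in> exponent_ideal U}"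
    by (metis (mono_tags, lifting) mem_Collect_eq single_in_exponent_ideal)
qed (rule upclosed_upscale)

lemma upscale_exponent_sum:
  "upscale m (exponent_sum U V) = exponent_sum (upscale m U) (upscale m V)"
proof (intro equalityI subsetI)
  fix w assume "w \<in> upscale m (exponent_sum U V)"
  then obtain b u v where "w = b + scale m (u + v)" "u \<in> U" "v \<in> V"
    by (auto simp: upscale_def exponent_sum_def)
  then have "w = (b + scale m u) + (0 + scale m v)" "u \<in> U" "v \<in> V"
    by (simp_all add: scale_add add.assoc)
  then show "w \<in> exponent_sum (upscale m U) (upscale m V)"
    unfolding upscale_def exponent_sum_def by blast
next
  fix w assume "w \<in> exponent_sum (upscale m U) (upscale m V)"
  then obtain b u c v where "w = (b + scale m u) + (c + scale m v)" "u \<in> U" "v \<in> V"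
    by (auto simp: upscale_def exponent_sum_def)
  then have "w = (b + c) + scale m (u + v)" "u \<in> U" "v \<in> V"
    by (simp_all add: scale_add ac_simps)
  then show "w \<in> upscale m (exponent_sum U V)"
    unfolding upscale_def exponent_sum_def by blast
qed

lemma upscale_UNIV: "upscale m UNIV = UNIV"
proof -
  have "\<exists>b u. w = b + scale m u" for w :: "'a \<Rightarrow>\<^sub>0 nat"
    by (rule exI[of _ w], rule exI[of _ 0]) simp
  then show ?thesis by (auto simp: upscale_def)
qed

lemma exponent_power_upscale: "exponent_power (upscale m U) s = upscale m (exponent_power U s)"
  by (induction s) (simp_all add: upscale_UNIV upscale_exponent_sum)

section \<open>Associated primes of monomial ideals\<close>

lemma primeideal_mpoly_ringD:
  fixes P :: "('n, 'k::comm_ring_1) mpoly set"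
  assumes "primeideal P mpoly_ring"
  shows "ideal P mpoly_ring" "1 \<notin> P" "f * g \<in> P \<Longrightarrow> f \<in> P \<or> g \<in> P"
proof -
  interpret primeideal P mpoly_ring by fact
  show "ideal P mpoly_ring" by (rule ideal_axioms)
  show "f * g \<in> P \<Longrightarrow> f \<in> P \<or> g \<in> P"
    using I_prime[of f g] by (simp add: mpoly_ring_def)
  show "1 \<notin> P" using one_imp_carrier I_notcarr by (auto simp: mpoly_ring_def)
qed

text \<open>
  Choose \<open>f\<close> with \<open>P = (I : f)\<close> and as few terms outside \<open>I\<close> as possible. For \<open>g \<in> P\<close>, a product
  \<open>x\<^sup>u x\<^sup>v\<close> of a term of \<open>g\<close> and a term of \<open>f\<close> outside \<open>I\<close> that arises only once lies in \<open>I\<close>,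
  so \<open>x\<^sup>u f\<close> has fewer terms outside \<open>I\<close>. If \<open>x\<^sup>u \<notin> P\<close>, primality gives \<open>(I : x\<^sup>u f) = P\<close>,
  against the choice of \<open>f\<close>; hence some term of \<open>g\<close> lies in \<open>P\<close>.
\<close>

lemma prime_colon_exponent_ideal_is_monomial:
  fixes f :: "('n, 'k::field) mpoly"
  assumes U: "upclosed U" and P: "primeideal P mpoly_ring"
    and colon: "P = {r. r * f \<in> exponent_ideal U}"
  shows "P = exponent_ideal {u. Poly_Mapping.single u 1 \<in> P}"
proof -
  note primeD = primeideal_mpoly_ringD[OF P]
  note IU = ideal_exponent_ideal[OF U, unfolded ideal_mpoly_ring_iff]
  define deg where "deg f = card (Poly_Mapping.keys f - U)" for f :: "('n, 'k) mpoly"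
  obtain h where h: "P = {r. r * h \<in> exponent_ideal U}"
    and least: "\<And>h'. P = {r. r * h' \<in> exponent_ideal U} \<Longrightarrow> deg h \<le> deg h'"
    using ex_has_least_nat[of "\<lambda>h. P = {r. r * h \<in> exponent_ideal U}" f deg] colon by blast
  have ne: "Poly_Mapping.keys h - U \<noteq> {}"
    using primeD(2) h by (auto simp: exponent_ideal_def)
  have some_key: "\<exists>u\<in>Poly_Mapping.keys g. Poly_Mapping.single u 1 \<in> P" if g: "g \<in> P" "g \<noteq> 0" for g
  proof -
    obtain u v where u: "u \<in> Poly_Mapping.keys g" and v: "v \<in> Poly_Mapping.keys h - U"
      and uniq: "\<And>u' v'. u' \<in> Poly_Mapping.keys g \<Longrightarrow> v' \<in> Poly_Mapping.keys h - U \<Longrightarrow>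
        u' + v' = u + v \<Longrightarrow> u' = u \<and> v' = v"
      using ex_unique_sum[of "Poly_Mapping.keys g" "Poly_Mapping.keys h - U"] ne g(2)
      by (auto simp: Bex_def)
    have uv: "u + v \<in> U"
    proof (rule ccontr)
      assume notin: "u + v \<notin> U"
      have "Poly_Mapping.lookup (g * h) (u + v) = Poly_Mapping.lookup g u * Poly_Mapping.lookup h v"
      proof (rule lookup_mult_unique_sum)
        \<comment> \<open>A key \<open>b\<close> of \<open>h\<close> inside \<open>U\<close> would
          force \<open>u + v\<close> into \<open>U\<close>, so only keys outside \<open>U\<close>
          compete, and for these \<open>uniq\<close> applies.\<close>
        show "a = u \<and> b = v" if "a \<in> Poly_Mapping.keys g" "b \<in> Poly_Mapping.keys h"
            "a + b = u + v" for a b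
          using uniq[of a b] that notin upclosedD[OF U] by (metis DiffI)
      qed (use u v in auto)
      then have "u + v \<in> Poly_Mapping.keys (g * h)"
        using u v by (simp add: in_keys_iff)
      then show False
        using g(1) notin by (auto simp: h exponent_ideal_def)
    qed
    have "Poly_Mapping.single u 1 \<in> P"
    proof (rule ccontr)
      assume nP: "Poly_Mapping.single u 1 \<notin> P"
      let ?h = "h * Poly_Mapping.single u 1"
      have "r * ?h \<in> exponent_ideal U \<longleftrightarrow> r \<in> P" for r
      proof -
        have "r * ?h = (r * Poly_Mapping.single u 1) * h" by (simp add: ac_simps)
        then have "r * ?h \<in> exponent_ideal U \<longleftrightarrow> r * Poly_Mapping.single u 1 \<in> P"
          by (simp only: h mem_Collect_eq)
        also have "\<dots> \<longleftrightarrow> r \<in> P"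
          using primeD nP by (metis ideal_mpoly_ring_iff mult.commute)
        finally show ?thesis .
      qed
      then have "deg h \<le> deg ?h" by (intro least) auto
      \<comment> \<open>Terms already in \<open>U\<close> stay there after the shift by
        \<open>u\<close>, and \<open>v\<close> now enters \<open>U\<close>; the survivors come from
        the other terms outside \<open>U\<close>.\<close>
      moreover have "Poly_Mapping.keys ?h - U \<subseteq> (\<lambda>c. c + u) ` (Poly_Mapping.keys h - U - {v})"
      proof -
        have "c + u \<in> U" if "c \<in> U" for c
          using upclosedD[OF U that] by (metis add.commute)
        then show ?thesis using uv by (auto simp: keys_mult_single add.commute)
      qed
      then have "deg ?h \<le> card (Poly_Mapping.keys h - U - {v})"
        unfolding deg_def by (rule surj_card_le[rotated]) simp
      moreover have "card (Poly_Mapping.keys h - U - {v}) < deg h"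
        unfolding deg_def using v by (intro card_Diff1_less) auto
      ultimately show False by simp
    qed
    with u show ?thesis by blast
  qed
  \<comment> \<open>One term of \<open>g\<close> in \<open>P\<close> can be subtracted without
    leaving \<open>P\<close>, so peeling off terms one at a time shows that every term lies in
    \<open>P\<close>.\<close>
  have "Poly_Mapping.keys g \<subseteq> {u. Poly_Mapping.single u 1 \<in> P}" if "g \<in> P" for g
    using that
  proof (induction "card (Poly_Mapping.keys g)" arbitrary: g rule: less_induct)
    case less
    show ?case
    proof (cases "g = 0")
      case False
      with some_key less.prems obtain u
        where u: "u \<in> Poly_Mapping.keys g" "Poly_Mapping.single u 1 \<in> P" by blast
      let ?t = "Poly_Mapping.single u (Poly_Mapping.lookup g u)"
      have "Poly_Mapping.single 0 (- Poly_Mapping.lookup g u) * Poly_Mapping.single u 1 \<in> P"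
        using u(2) primeD(1) by (auto simp: ideal_mpoly_ring_iff)
      then have "g + - ?t \<in> P"
        using less.prems primeD(1) by (auto simp: ideal_mpoly_ring_iff mult_single single_uminus)
      then have "g - ?t \<in> P" by simp
      moreover have keys: "Poly_Mapping.keys (g - ?t) = Poly_Mapping.keys g - {u}"
        by (auto simp: in_keys_iff lookup_minus lookup_single when_def split: if_splits)
      moreover have "card (Poly_Mapping.keys g - {u}) < card (Poly_Mapping.keys g)"
        using u(1) by (intro card_Diff1_less) auto
      ultimately have "Poly_Mapping.keys g - {u} \<subseteq> {u. Poly_Mapping.single u 1 \<in> P}"
        using less.hyps[of "g - ?t"] by simp
      with u show ?thesis by blast
    qed simp
  qed
  moreover have "exponent_ideal {u. Poly_Mapping.single u 1 \<in> P} \<subseteq> P"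
    by (rule exponent_ideal_subset[OF primeD(1)]) simp
  ultimately show ?thesis
    by (auto simp: exponent_ideal_def)
qed

text \<open>The exponents of the monomials in \<open>(I : x^a)\<close> are those that adding
  \<open>a\<close> moves into \<open>U\<close>. Associated primes thus become a condition on shifts
  of \<open>U\<close>, once the annihilated element can be taken to be a monomial.\<close>

lemma Ass_exponent_ideal_iff:
  fixes P :: "('n, 'k::field) mpoly set"
  assumes U: "upclosed U"
  shows "P \<in> Ass mpoly_ring (exponent_ideal U) \<longleftrightarrow>
    primeideal P mpoly_ring \<and> (\<exists>V. P = exponent_ideal V \<and> (\<exists>a. \<forall>c. c \<in> V \<longleftrightarrow> c + a \<in> U))"
proof -
  interpret ideal "exponent_ideal U :: ('n, 'k) mpoly set" mpoly_ring
    by (rule ideal_exponent_ideal[OF U])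
  have Ass: "P \<in> Ass mpoly_ring (exponent_ideal U) \<longleftrightarrow>
      primeideal P mpoly_ring \<and> (\<exists>f. P = {r. r * f \<in> exponent_ideal U})"
    unfolding Ass_iff_colon by (simp add: mpoly_ring_def)
  show ?thesis
    unfolding Ass
  proof (intro conj_cong refl iffI)
    assume "\<exists>V. P = exponent_ideal V \<and> (\<exists>a. \<forall>c. c \<in> V \<longleftrightarrow> c + a \<in> U)"
    then obtain V a where "P = exponent_ideal V" "\<forall>c. c \<in> V \<longleftrightarrow> c + a \<in> U" by blast
    then have "P = {r. r * Poly_Mapping.single a 1 \<in> exponent_ideal U}"
      by (auto simp: exponent_ideal_def keys_mult_single)
    then show "\<exists>f. P = {r. r * f \<in> exponent_ideal U}" by blast
  next
    assume P: "primeideal P mpoly_ring" and "\<exists>f. P = {r. r * f \<in> exponent_ideal U}"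
    then obtain f where f: "P = {r. r * f \<in> exponent_ideal U}" by blast
    note primeD = primeideal_mpoly_ringD[OF P]
    define V where "V = {u. Poly_Mapping.single u (1::'k) \<in> P}"
    have PV: "P = exponent_ideal V"
      unfolding V_def by (rule prime_colon_exponent_ideal_is_monomial[OF U P f])
    \<comment> \<open>As \<open>I\<close> is monomial, \<open>x^c * f\<close> lies in
      \<open>I\<close> only if each of its terms does.\<close>
    have fwd: "c + t \<in> U" if "c \<in> V" "t \<in> Poly_Mapping.keys f" for c t
    proof -
      have "f * Poly_Mapping.single c 1 \<in> exponent_ideal U"
        using that(1) f by (auto simp: V_def mult.commute)
      then show ?thesis
        using that(2) by (auto simp: exponent_ideal_def keys_mult_single add.commute)
    qed
    txt \<open>Since \<open>P\<close> is prime and contains the product of the \<open>(I : x\<^sup>t)\<close> over the terms of \<open>f\<close>,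
      it contains one of them.\<close>
    have "\<exists>t\<in>Poly_Mapping.keys f. \<forall>c. c + t \<in> U \<longrightarrow> c \<in> V"
    proof (rule ccontr)
      assume "\<not> ?thesis"
      then obtain c where c: "\<And>t. t \<in> Poly_Mapping.keys f \<Longrightarrow> c t + t \<in> U \<and> c t \<notin> V"
        by metis
      \<comment> \<open>The sum of the \<open>c t\<close> is the exponent of the product of the
        monomials \<open>x^(c t)\<close>, none of which lies in the prime \<open>P\<close>.\<close>
      have "(\<Sum>t\<in>T. c t) \<notin> V" if "finite T" "T \<subseteq> Poly_Mapping.keys f" for T
        using that
      proof (induction T)
        case empty
        show ?case using primeD(2) by (simp add: V_def)
      next
        case (insert t T)
        have "c t \<notin> V" "(\<Sum>t\<in>T. c t) \<notin> V" using insert c by auto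
        then show ?case
          using primeD(3)[of "Poly_Mapping.single (c t) 1" "Poly_Mapping.single (\<Sum>t\<in>T. c t) 1"]
            insert.hyps by (auto simp: V_def mult_single)
      qed
      then have "(\<Sum>t\<in>Poly_Mapping.keys f. c t) \<notin> V" by simp
      \<comment> \<open>For each term \<open>t\<close> the summand \<open>c t\<close> alone already
        moves \<open>t\<close> into \<open>U\<close>, so the product monomial sends all of
        \<open>f\<close> into \<open>I\<close>.\<close>
      moreover have "(\<Sum>t\<in>Poly_Mapping.keys f. c t) + t \<in> U" if "t \<in> Poly_Mapping.keys f" for t
      proof -
        have "(\<Sum>t\<in>Poly_Mapping.keys f. c t) + t =
            (\<Sum>t\<in>Poly_Mapping.keys f - {t}. c t) + (c t + t)"
          using that by (simp add: sum.remove ac_simps)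
        then show ?thesis using c[OF that] upclosedD[OF U] by simp
      qed
      then have "f * Poly_Mapping.single (\<Sum>t\<in>Poly_Mapping.keys f. c t) 1 \<in> exponent_ideal U"
        by (auto simp: exponent_ideal_def keys_mult_single add.commute)
      then have "Poly_Mapping.single (\<Sum>t\<in>Poly_Mapping.keys f. c t) 1 \<in> P"
        by (simp add: f mult.commute)
      ultimately show False by (simp add: V_def)
    qed
    with fwd PV show "\<exists>V. P = exponent_ideal V \<and> (\<exists>a. \<forall>c. c \<in> V \<longleftrightarrow> c + a \<in> U)"
      by blast
  qed
qed

section \<open>Associated primes under square powers\<close>

text \<open>\<open>x^(m * c)\<close> is the \<open>m\<close>-th power of \<open>x^c\<close>, and a
  prime ideal contains a positive power exactly when it contains the base.\<close>

lemma prime_exponent_ideal_scale_iff: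
  assumes P: "primeideal (exponent_ideal V :: ('n::finite, 'k::comm_ring_1) mpoly set) mpoly_ring"
    and m: "m > 0"
  shows "scale m c \<in> V \<longleftrightarrow> c \<in> V"
proof
  note primeD = primeideal_mpoly_ringD[OF P]
  have V: "a \<in> V \<or> b \<in> V" if "a + b \<in> V" for a b
    using primeD(3)[of "Poly_Mapping.single a 1" "Poly_Mapping.single b 1"] that
    by (simp add: mult_single)
  have "0 \<notin> V"
    using primeD(2) by (metis single_in_exponent_ideal single_one)
  then show "scale m c \<in> V \<Longrightarrow> c \<in> V"
    by (induction m) (use V in \<open>auto simp: scale_Suc\<close>)
  assume c: "c \<in> V"
  obtain k where "m = Suc k" using m gr0_implies_Suc by blast
  moreover have "Poly_Mapping.single (scale k c) 1 * Poly_Mapping.single c (1::'k) \<in> exponent_ideal V"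
    using primeD(1) c by (simp add: ideal_mpoly_ring_iff)
  ultimately show "scale m c \<in> V"
    by (simp add: mult_single scale_Suc add.commute)
qed

lemma upclosed_if_ideal:
  assumes "ideal (exponent_ideal V :: ('n, 'k::comm_ring_1) mpoly set) mpoly_ring"
  shows "upclosed V"
  unfolding upclosed_def
proof (intro ballI allI)
  fix u v assume "u \<in> V"
  then have "Poly_Mapping.single v 1 * Poly_Mapping.single u (1::'k) \<in> exponent_ideal V"
    using assms by (simp add: ideal_mpoly_ring_iff)
  then show "v + u \<in> V" by (simp add: mult_single)
qed

lemma Ass_upscale:
  assumes U: "upclosed U" and m: "m > 0"
  shows "Ass mpoly_ring (exponent_ideal (upscale m U)) =
    Ass mpoly_ring (exponent_ideal U :: ('n::finite, 'k::field) mpoly set)"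
proof -
  have shift_iff: "(\<exists>a. \<forall>c. c \<in> V \<longleftrightarrow> c + a \<in> upscale m U) \<longleftrightarrow> (\<exists>a. \<forall>c. c \<in> V \<longleftrightarrow> c + a \<in> U)"
    if prime: "primeideal (exponent_ideal V :: ('n, 'k) mpoly set) mpoly_ring" for V
  proof
    have V: "upclosed V"
      using primeideal_mpoly_ringD(1)[OF prime] by (rule upclosed_if_ideal)
    {
      assume "\<exists>a. \<forall>c. c \<in> V \<longleftrightarrow> c + a \<in> upscale m U"
      then obtain b where b: "\<And>c. c \<in> V \<longleftrightarrow> c + b \<in> upscale m U" by blast
      \<comment> \<open>Replacing \<open>c\<close> by \<open>m * c\<close> makes the division exact
        in that summand: \<open>(m * c + b) div m = c + b div m\<close>.\<close>
      have "c \<in> V \<longleftrightarrow> c + exponent_vec (\<lambda>i. Poly_Mapping.lookup b i div m) \<in> U" for c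
      proof -
        have "c \<in> V \<longleftrightarrow> scale m c \<in> V"
          using prime_exponent_ideal_scale_iff[OF prime m] by simp
        also have "\<dots> \<longleftrightarrow> exponent_vec (\<lambda>i. Poly_Mapping.lookup (scale m c + b) i div m) \<in> U"
          by (simp only: b upscale_iff_div[OF U m])
        also have "exponent_vec (\<lambda>i. Poly_Mapping.lookup (scale m c + b) i div m) =
            c + exponent_vec (\<lambda>i. Poly_Mapping.lookup b i div m)"
          by (rule poly_mapping_eqI) (use m in \<open>simp add: lookup_add\<close>)
        finally show ?thesis .
      qed
      then show "\<exists>a. \<forall>c. c \<in> V \<longleftrightarrow> c + a \<in> U" by blast
    }
    assume "\<exists>a. \<forall>c. c \<in> V \<longleftrightarrow> c + a \<in> U"
    then obtain a where a: "\<And>c. c \<in> V \<longleftrightarrow> c + a \<in> U" by blast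
    \<comment> \<open>The summand \<open>m - 1\<close> turns the rounding down in
      \<open>upscale_iff_div\<close> into rounding up of \<open>c / m\<close>.\<close>
    define b where "b = exponent_vec (\<lambda>i. m * Poly_Mapping.lookup a i + (m - 1))"
    have "c \<in> V \<longleftrightarrow> c + b \<in> upscale m U" for c
    proof -
      \<comment> \<open>\<open>d\<close> is the coordinatewise ceiling of \<open>c / m\<close>. It
        satisfies \<open>d \<le> c \<le> m * d\<close>, which together with the invariance of
        \<open>V\<close> under scaling makes \<open>c\<close> and \<open>d\<close> equivalent for
        membership in \<open>V\<close>.\<close>
      define d where "d = exponent_vec (\<lambda>i. (Poly_Mapping.lookup c i + (m - 1)) div m)"
      have "exponent_vec (\<lambda>i. Poly_Mapping.lookup (c + b) i div m) = d + a"
      proof (rule poly_mapping_eqI)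
        fix i
        have "(Poly_Mapping.lookup c i + (m * Poly_Mapping.lookup a i + (m - 1))) div m =
            ((Poly_Mapping.lookup c i + (m - 1)) + m * Poly_Mapping.lookup a i) div m"
          by (simp only: ac_simps)
        also have "\<dots> = (Poly_Mapping.lookup c i + (m - 1)) div m + Poly_Mapping.lookup a i"
          using m by (subst div_mult_self2) auto
        finally show "Poly_Mapping.lookup
            (exponent_vec (\<lambda>i. Poly_Mapping.lookup (c + b) i div m)) i =
          Poly_Mapping.lookup (d + a) i"
          by (simp add: lookup_add b_def d_def)
      qed
      then have "c + b \<in> upscale m U \<longleftrightarrow> d \<in> V"
        by (simp add: upscale_iff_div[OF U m] a)
      also have "\<dots> \<longleftrightarrow> c \<in> V"
      proof
        assume "d \<in> V"
        moreover have "Poly_Mapping.lookup d i \<le> Poly_Mapping.lookup c i" for i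
        proof -
          have "Poly_Mapping.lookup c i + (m - 1) < m * Suc (Poly_Mapping.lookup c i)"
            using m by (cases m) simp_all
          then show ?thesis
            using m by (simp add: d_def div_less_iff_less_mult mult.commute flip: less_Suc_eq_le)
        qed
        ultimately show "c \<in> V" by (rule upclosed_lookup_mono[OF V])
      next
        assume "c \<in> V"
        moreover have "Poly_Mapping.lookup c i \<le> Poly_Mapping.lookup (scale m d) i" for i
        proof -
          \<comment> \<open>The remainder is at most \<open>m - 1\<close>, so cancelling it against
            the added \<open>m - 1\<close> leaves \<open>c \<le> m * d\<close>.\<close>
          have "Poly_Mapping.lookup c i + (m - 1) = m * Poly_Mapping.lookup d i +
              (Poly_Mapping.lookup c i + (m - 1)) mod m"
            by (simp add: d_def)
          moreover have "(Poly_Mapping.lookup c i + (m - 1)) mod m < m" using m by simp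
          ultimately show ?thesis using m unfolding lookup_scale by linarith
        qed
        ultimately have "scale m d \<in> V" by (rule upclosed_lookup_mono[OF V])
        then show "d \<in> V" using prime_exponent_ideal_scale_iff[OF prime m] by simp
      qed
      finally show ?thesis by simp
    qed
    then show "\<exists>a. \<forall>c. c \<in> V \<longleftrightarrow> c + a \<in> upscale m U" by blast
  qed
  have "(\<exists>V. P = exponent_ideal V \<and> (\<exists>a. \<forall>c. c \<in> V \<longleftrightarrow> c + a \<in> upscale m U)) \<longleftrightarrow>
      (\<exists>V. P = exponent_ideal V \<and> (\<exists>a. \<forall>c. c \<in> V \<longleftrightarrow> c + a \<in> U))"
    if "primeideal P mpoly_ring" for P :: "('n, 'k) mpoly set"
    by (rule ex_cong1, rule conj_cong[OF refl], rule shift_iff) (use that in simp)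
  then have Ass_iff: "P \<in> Ass mpoly_ring (exponent_ideal (upscale m U)) \<longleftrightarrow>
      P \<in> Ass mpoly_ring (exponent_ideal U)" for P :: "('n, 'k) mpoly set"
    unfolding Ass_exponent_ideal_iff[OF U] Ass_exponent_ideal_iff[OF upclosed_upscale]
    by (rule conj_cong[OF refl])
  show ?thesis by (rule Set.set_eqI) (rule Ass_iff)
qed

theorem theorem3p4:
  fixes I :: "('n::finite, 'k::field) mpoly set"
  assumes "monomial_ideal I"
    and "normally_torsion_free mpoly_ring I"
  shows "\<forall>m::nat. m \<ge> 2 \<longrightarrow> normally_torsion_free mpoly_ring (ideal_square_power m I)"
proof (intro allI impI)
  fix m :: nat assume "m \<ge> 2"
  then have m: "m > 0" by simp
  obtain U where U: "upclosed U" and I: "I = exponent_ideal U"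
    using monomial_ideal_eq_exponent_ideal[OF assms(1)] .
  show "normally_torsion_free mpoly_ring (ideal_square_power m I)"
    \<comment> \<open>The \<open>s\<close>-th power of the square power has exponent set
      \<open>upscale m (exponent_power U s)\<close>. \<open>Ass_upscale\<close> removes
      \<open>upscale m\<close> on both sides of the inclusion, leaving the hypothesis on
      \<open>I\<close>.\<close>
    using assms(2)
    by (simp add: normally_torsion_free_def I ideal_square_power_exponent_ideal[OF U]
        ideal_power_exponent_ideal upclosed_upscale U exponent_power_upscale
        Ass_upscale[OF _ m] upclosed_exponent_power)
qed

end
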